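(* For $n\ge1$, $$|E_n^{\mathrm{ax}}|=4^{n-1}+2^n-2 .$$ More precisely, the three vertices of every triangle in $E_n^{\mathrm{ax}}$ can be labelled by the three main axes so that their scaled integer centroid coordinates are $$(x,0),\qquad (0,y),\qquad (-z,-z),\qquad x,y,z\in R_n,$$ and, with this labelling, every triangle in $E_n^{\mathrm{ax}}$ belongs to exactly one of the two branches $$E_n^{\mathrm{ax},=}=\{T\in E_n^{\mathrm{ax}}: x=y=z\},\qquad E_n^{\mathrm{ax},0}=\{T\in E_n^{\mathrm{ax}}: x+y+z=0\},$$ and $$|E_n^{\mathrm{ax},=}|=2^n-1,\qquad |E_n^{\mathrm{ax},0}|=4^{n-1}-1 .$$
   Context: $\Delta_n=\{i,j,k,e\}^n$ is the set of words $b=b_1b_2\cdots b_n$ of length $n$ in the four symbols $i,j,k,e$. Put $v(i)=(\cos 210^\circ,\sin 210^\circ)$, $v(j)=(\cos 90^\circ,\sin 90^\circ)$, $v(k)=(\cos 330^\circ,\sin 330^\circ)$, $v(e)=(0,0)$ in $\mathbb R^2$. Fix a real $d_1>0$ and put $d_r=d_1/2^{r-1}$. The centroid map $P:\Delta_n\to\mathbb R^2$ is $$P(b)=\sum_{r=1}^n \sigma_r(b)\,d_r\,v(b_r),\qquad \sigma_r(b)=(-1)^{\#\{s<r:\ b_s=e\}}.$$ $E_n$ is the set of unordered triples $\{b_1,b_2,b_3\}$ of distinct words in $\Delta_n$ such that $P(b_1),P(b_2),P(b_3)$ are the vertices of a nondegenerate equilateral triangle. Scaled integer centroid coordinates: with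 $\lambda(i)=(1,0)$, $\lambda(j)=(0,1)$, $\lambda(k)=(-1,-1)$, $\lambda(e)=(0,0)$, $$\Lambda_n(b)=\sum_{r=1}^n\sigma_r(b)\,2^{n-r}\lambda(b_r)\in\mathbb Z^2 .$$ If $\Lambda_n(b)=(X,Y)$ then $\frac{2^{n-1}}{d_1}P(b)=X\,v(i)+Y\,v(j)$, and $\Lambda_n$ is injective. The three main axes ($I$-, $J$-, $K$-axis) are the lines through the origin spanned by $v(i)$, $v(j)$, $v(k)$ respectively; in the coordinates $\Lambda_n$ their points have the forms $(x,0)$, $(0,y)$, $(-z,-z)$. The origin $P(e_n)$, $e_n=ee\cdots e$, lies on all three axes. $R_n$ is the set of integers $x$ such that $(x,0)\in\Lambda_n(\Delta_n)$ (the same parameter set describes the occurring points $(0,x)$ and $(-x,-x)$ on the other two axes). Finally $$E_n^{\mathrm{ax}}=\{T\in E_n:\ \text{the centroid of each vertex of } T \text{ lies on some main axis}\}.$$ *)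

theory Defs
  imports "HOL-Analysis.Analysis"
begin

datatype letter = I | J | K | E

definition words :: "nat \<Rightarrow> letter list set" where
  "words n = {b. length b = n}"

text \<open>The angles are 210, 90 and 330 degrees.\<close>

fun direction :: "letter \<Rightarrow> real \<times> real" where
  "direction I = (cos (210 * pi / 180), sin (210 * pi / 180))"
| "direction J = (cos (90 * pi / 180), sin (90 * pi / 180))"
| "direction K = (cos (330 * pi / 180), sin (330 * pi / 180))"
| "direction E = (0, 0)"

text \<open>
  List positions start at 0, so position \<open>r\<close> holds the letter with index \<open>r + 1\<close> of the word:
  the step length \<open>d / 2 ^ (r - 1)\<close> of the \<open>r\<close>-th letter becomes \<open>d / 2 ^ r\<close>, and the scaled
  weight \<open>2 ^ (n - r)\<close> becomes \<open>2 ^ (n - Suc r)\<close>.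
\<close>

definition orientation :: "letter list \<Rightarrow> nat \<Rightarrow> 'a::ring_1" where
  "orientation b r = (- 1) ^ card {s. s < r \<and> b ! s = E}"

definition centroid :: "real \<Rightarrow> letter list \<Rightarrow> real \<times> real" where
  "centroid d b = (\<Sum>r<length b. (orientation b r * (d / 2 ^ r)) *\<^sub>R direction (b ! r))"

fun int_direction :: "letter \<Rightarrow> int \<times> int" where
  "int_direction I = (1, 0)"
| "int_direction J = (0, 1)"
| "int_direction K = (- 1, - 1)"
| "int_direction E = (0, 0)"

definition int_centroid :: "letter list \<Rightarrow> int \<times> int" where
  "int_centroid b =
    (\<Sum>r<length b. orientation b r * 2 ^ (length b - Suc r) * fst (int_direction (b ! r)),
     \<Sum>r<length b. orientation b r * 2 ^ (length b - Suc r) * snd (int_direction (b ! r)))"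

definition equilateral :: "'a::metric_space \<Rightarrow> 'a \<Rightarrow> 'a \<Rightarrow> bool" where
  "equilateral A B C \<longleftrightarrow> A \<noteq> B \<and> dist A B = dist B C \<and> dist B C = dist C A"

definition triangles :: "real \<Rightarrow> nat \<Rightarrow> letter list set set" where
  "triangles d n = {{b1, b2, b3} | b1 b2 b3.
     b1 \<in> words n \<and> b2 \<in> words n \<and> b3 \<in> words n \<and> distinct [b1, b2, b3] \<and>
     equilateral (centroid d b1) (centroid d b2) (centroid d b3)}"

definition main_axis :: "letter \<Rightarrow> (real \<times> real) set" where
  "main_axis a = span {direction a}"

definition axial_triangles :: "real \<Rightarrow> nat \<Rightarrow> letter list set set" where
  "axial_triangles d n =
    {T \<in> triangles d n. \<forall>b\<in>T. \<exists>a\<in>{I, J, K}. centroid d b \<in> main_axis a}"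

definition axis_params :: "nat \<Rightarrow> int set" where
  "axis_params n = {x. (x, 0) \<in> int_centroid ` words n}"

definition axis_labelling :: "letter list set \<Rightarrow> int \<Rightarrow> int \<Rightarrow> int \<Rightarrow> bool" where
  "axis_labelling T x y z \<longleftrightarrow> (\<exists>b1 b2 b3. T = {b1, b2, b3} \<and>
     int_centroid b1 = (x, 0) \<and> int_centroid b2 = (0, y) \<and> int_centroid b3 = (- z, - z))"

text \<open>
  A labelling is determined by the triangle, also when a vertex is the origin, which lies on all
  three axes. The existential quantifiers in the two branches below hence involve no choice.
\<close>

lemma axis_labelling_unique:
  assumes "axis_labelling T x y z" "axis_labelling T x' y' z'"
  shows "x = x' \<and> y = y' \<and> z = z'"
proof -
  have img: "int_centroid ` T = {(x, 0), (0, y), (- z, - z)}"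
    using assms(1) by (auto simp: axis_labelling_def)
  have img': "int_centroid ` T = {(x', 0), (0, y'), (- z', - z')}"
    using assms(2) by (auto simp: axis_labelling_def)
  have eq: "{(x, 0), (0, y), (- z, - z)} = {(x', 0), (0, y'), (- z', - z')}"
    using img img' by simp
  have "(x, 0) \<in> {(x', 0), (0, y'), (- z', - z')}" "(0, y) \<in> {(x', 0), (0, y'), (- z', - z')}"
    "(- z, - z) \<in> {(x', 0), (0, y'), (- z', - z')}"
    "(x', 0) \<in> {(x, 0), (0, y), (- z, - z)}" "(0, y') \<in> {(x, 0), (0, y), (- z, - z)}"
    "(- z', - z') \<in> {(x, 0), (0, y), (- z, - z)}"
    using eq by blast+
  then show ?thesis by auto
qed

definition axial_triangles_eq :: "real \<Rightarrow> nat \<Rightarrow> letter list set set" where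
  "axial_triangles_eq d n =
    {T \<in> axial_triangles d n. \<exists>x y z. axis_labelling T x y z \<and> x = y \<and> y = z}"

definition axial_triangles_zero :: "real \<Rightarrow> nat \<Rightarrow> letter list set set" where
  "axial_triangles_zero d n =
    {T \<in> axial_triangles d n. \<exists>x y z. axis_labelling T x y z \<and> x + y + z = 0}"

end

theory Submission
  imports Defs
begin

text \<open>
  The two coordinate directions meet at an angle of 120 degrees, so squared distances between scaled
  centroids are values of \<open>X\<^sup>2 - X Y + Y\<^sup>2\<close>. On the main axes this makes the geometry elementary. Points
  with parameters \<open>s\<close> and \<open>t\<close> on two different axes have squared distance \<open>s\<^sup>2 + s t + t\<^sup>2\<close>, and
  equality of two such values that share a parameter factors: for points on three different axes,
  being equilateral means \<open>x = y = z\<close> or \<open>x + y + z = 0\<close>, the origin taken three times being excluded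
  (\<open>lattice_equilateral_three_axes\<close>). If two vertices lie on one axis, then one of them is the origin,
  which may be assigned to the missing axis instead (\<open>lattice_equilateral_same_axis\<close>).

  A centroid modulo 2 determines the last letter, so a word whose centroid lies on the axis of \<open>a\<close>
  contains only the letters \<open>a\<close> and \<open>E\<close> (\<open>axis_wordI\<close>), and all three axes carry the same parameter
  function on binary words. Axial triangles thus correspond to triples of binary words of length \<open>n\<close>
  (\<open>axial_triangles_as_triples\<close>). The triples with equal entries number \<open>2 ^ n\<close>; the two branches share
  only the degenerate triple of the origin, which accounts for the subtractions.

  The substance is the count \<open>4 ^ (n - 1)\<close> of triples with \<open>x + y + z = 0\<close> (\<open>card_zero_sum\<close>). It
  rests on an invariant modulo 3 (\<open>int_centroid_mod_3\<close>): the parameter of a word plus its total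
  orientation is \<open>(- 1) ^ n\<close>. For a triple with parameter sum \<open>S\<close> and orientations \<open>e, f, g\<close> this gives
  \<open>S + e + f + g = 0\<close> modulo 3. Appending one binary digit to each word turns \<open>S\<close> into
  \<open>2 S + a e + b f + c g\<close>, with \<open>a, b, c\<close> the new digits. The congruence makes the triples with
  \<open>\<bar>S\<bar> \<le> 1\<close> self-reproducing: such a sum arises only from a triple that is itself of this kind, and
  each triple of this kind has four such extensions, exactly one of which has sum 0 (\<open>card_children\<close>).
  Hence there are \<open>4 ^ n\<close> triples of this kind of length \<open>n\<close>, and as many triples of sum 0 of length
  \<open>n + 1\<close>.
\<close>

section \<open>Scaled centroids\<close>

lemma orientation_snoc:
  assumes "r \<le> length b"
  shows "orientation (b @ [c]) r = orientation b r"
proof -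
  have "{s. s < r \<and> (b @ [c]) ! s = E} = {s. s < r \<and> b ! s = E}"
    using assms by (auto simp: nth_append)
  then show ?thesis by (simp add: orientation_def)
qed

lemma orientation_Suc:
  "orientation b (Suc r) = (if b ! r = E then - orientation b r else orientation b r)"
proof -
  have "{s. s < Suc r \<and> b ! s = E} =
      (if b ! r = E then insert r {s. s < r \<and> b ! s = E} else {s. s < r \<and> b ! s = E})"
    by (auto simp: less_Suc_eq)
  then show ?thesis by (simp add: orientation_def)
qed

lemma orientation_cases: "orientation b r = (1::int) \<or> orientation b r = (- 1 :: int)"
  by (simp add: orientation_def minus_one_power_iff)

text \<open>
  The sign that the next letter would get if it were appended to the word.
\<close>

definition total_orientation :: "letter list \<Rightarrow> int" where
  "total_orientation b = orientation b (length b)"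

lemma total_orientation_Nil [simp]: "total_orientation [] = 1"
  by (simp add: total_orientation_def orientation_def)

lemma total_orientation_snoc [simp]:
  "total_orientation (b @ [c]) = (if c = E then - total_orientation b else total_orientation b)"
  by (simp add: total_orientation_def orientation_Suc orientation_snoc)

lemma total_orientation_cases:
  obtains "total_orientation b = 1" | "total_orientation b = - 1"
  using orientation_cases by (auto simp: total_orientation_def)

lemma int_centroid_Nil [simp]: "int_centroid [] = (0, 0)"
  by (simp add: int_centroid_def)

lemma int_centroid_snoc [simp]:
  "int_centroid (b @ [c]) =
    (2 * fst (int_centroid b) + total_orientation b * fst (int_direction c),
     2 * snd (int_centroid b) + total_orientation b * snd (int_direction c))"
proof -
  have weight: "(2::int) ^ (length b - r) = 2 * 2 ^ (length b - Suc r)" if "r < length b" for r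
    using that by (metis Suc_diff_Suc power_Suc)
  have "(\<Sum>r<length b. orientation (b @ [c]) r * 2 ^ (length b - r) * p (int_direction ((b @ [c]) ! r)))
      = 2 * (\<Sum>r<length b. orientation b r * 2 ^ (length b - Suc r) * p (int_direction (b ! r)))"
    for p :: "int \<times> int \<Rightarrow> int"
    unfolding sum_distrib_left
    by (rule sum.cong) (auto simp: orientation_snoc nth_append weight)
  then show ?thesis
    by (simp add: int_centroid_def orientation_snoc total_orientation_def)
qed

lemma centroid_snoc:
  "centroid d (b @ [c]) =
    centroid d b + (real_of_int (total_orientation b) * (d / 2 ^ length b)) *\<^sub>R direction c"
proof -
  have "real_of_int (total_orientation b) = orientation b (length b)"
    by (simp add: total_orientation_def orientation_def)
  moreover have "(\<Sum>r<length b. (orientation (b @ [c]) r * (d / 2 ^ r)) *\<^sub>R direction ((b @ [c]) ! r)) =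
      (\<Sum>r<length b. (orientation b r * (d / 2 ^ r)) *\<^sub>R direction (b ! r))"
    by (rule sum.cong) (auto simp: orientation_snoc nth_append)
  ultimately show ?thesis
    by (simp add: centroid_def orientation_snoc)
qed

text \<open>
  Modulo 3 the vectors of \<open>I\<close>, \<open>J\<close>, \<open>K\<close> all have coordinate sum 1, so the coordinate sum does not
  distinguish them. Appending a letter doubles the coordinate sum and then either adds the orientation
  or flips it; both change the left-hand side to its negative modulo 3.
\<close>

lemma int_centroid_mod_3:
  "(fst (int_centroid b) + snd (int_centroid b) + total_orientation b) mod 3 = (- 1) ^ length b mod 3"
proof (induction b rule: rev_induct)
  case Nil
  then show ?case by simp
next
  case (snoc c b)
  let ?S = "\<lambda>b. fst (int_centroid b) + snd (int_centroid b) + total_orientation b"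
  have "?S (b @ [c]) + ?S b = 3 * (fst (int_centroid b) + snd (int_centroid b)
      + (if c = I \<or> c = J then total_orientation b else 0))"
    by (cases c) (simp_all add: algebra_simps)
  then have "3 dvd ?S (b @ [c]) + ?S b" by (metis dvd_triv_left)
  moreover have "3 dvd ?S b - (- 1) ^ length b"
    using snoc.IH by (simp add: mod_eq_dvd_iff)
  ultimately have "3 dvd (?S (b @ [c]) + ?S b) - (?S b - (- 1) ^ length b)"
    by (rule dvd_diff)
  moreover have "(?S (b @ [c]) + ?S b) - (?S b - (- 1) ^ length b) =
      ?S (b @ [c]) - (- 1) ^ length (b @ [c])"
    by simp
  ultimately show ?case by (simp only: mod_eq_dvd_iff)
qed

text \<open>
  The centroid modulo 3 fixes the orientation modulo 3, and 1 and \<open>- 1\<close> differ modulo 3.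
\<close>

lemma total_orientation_determined:
  assumes "length b = length b'" "int_centroid b = int_centroid b'"
  shows "total_orientation b = total_orientation b'"
proof -
  have "3 dvd total_orientation b - total_orientation b'"
    using int_centroid_mod_3[of b] int_centroid_mod_3[of b'] assms
    by (simp add: mod_eq_dvd_iff) (metis add_diff_cancel_left mod_eq_dvd_iff)
  then show ?thesis
    by (cases b rule: total_orientation_cases; cases b' rule: total_orientation_cases) auto
qed

lemma int_direction_inj_mod_2:
  assumes "even (fst (int_direction c)) \<longleftrightarrow> even (fst (int_direction c'))"
    and "even (snd (int_direction c)) \<longleftrightarrow> even (snd (int_direction c'))"
  shows "c = c'"
  using assms by (cases c; cases c') auto

text \<open>
  A word can be read off from its centroid from the last letter backwards: the centroid modulo 2 gives
  the letter. Peeling it off requires the orientation in front of it, which the centroid also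
  determines.
\<close>

lemma int_centroid_inj:
  assumes "length b = length b'" "int_centroid b = int_centroid b'"
  shows "b = b'"
  using assms
proof (induction b arbitrary: b' rule: rev_induct)
  case Nil
  then show ?case by simp
next
  case (snoc c b)
  from snoc.prems(1) obtain b0 c' where b': "b' = b0 @ [c']" and len: "length b = length b0"
    by (cases b' rule: rev_cases) auto
  have odd: "odd (total_orientation x)" for x
    by (cases x rule: total_orientation_cases) auto
  have "even (fst (int_centroid (b @ [c]))) \<longleftrightarrow> even (fst (int_centroid (b0 @ [c'])))"
    "even (snd (int_centroid (b @ [c]))) \<longleftrightarrow> even (snd (int_centroid (b0 @ [c'])))"
    using snoc.prems(2) b' by simp_all
  then have "c = c'"
    by (intro int_direction_inj_mod_2) (simp_all add: odd)
  moreover have "total_orientation (b @ [c]) = total_orientation b'"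
    using snoc.prems by (rule total_orientation_determined)
  ultimately have "total_orientation b = total_orientation b0"
    using b' by (simp split: if_splits)
  then have "int_centroid b = int_centroid b0"
    using snoc.prems(2) b' \<open>c = c'\<close> by (simp add: prod_eq_iff)
  then show ?case using snoc.IH len b' \<open>c = c'\<close> by simp
qed

section \<open>Words on a main axis\<close>

definition axis_point :: "letter \<Rightarrow> int \<Rightarrow> int \<times> int" where
  "axis_point a t = (t * fst (int_direction a), t * snd (int_direction a))"

text \<open>
  The binary word records where the letter \<open>a\<close> stands; all other positions hold \<open>E\<close>.
\<close>

definition axis_word :: "letter \<Rightarrow> bool list \<Rightarrow> letter list" where
  "axis_word a w = map (\<lambda>c. if c then a else E) w"

definition axis_sign :: "bool list \<Rightarrow> int" where
  "axis_sign w = total_orientation (axis_word I w)"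

text \<open>
  The choice of \<open>I\<close> here and in the sign above is immaterial, as \<open>int_centroid_axis_word\<close> and
  \<open>total_orientation_axis_word\<close> show.
\<close>

definition axis_coord :: "bool list \<Rightarrow> int" where
  "axis_coord w = fst (int_centroid (axis_word I w))"

lemma length_axis_word [simp]: "length (axis_word a w) = length w"
  by (simp add: axis_word_def)

lemma axis_word_snoc [simp]: "axis_word a (w @ [c]) = axis_word a w @ [if c then a else E]"
  by (simp add: axis_word_def)

lemma axis_word_Nil [simp]: "axis_word a [] = []"
  by (simp add: axis_word_def)

lemma axis_coord_Nil [simp]: "axis_coord [] = 0"
  and axis_sign_Nil [simp]: "axis_sign [] = 1"
  by (simp_all add: axis_coord_def axis_sign_def)

lemma axis_coord_snoc [simp]:
  "axis_coord (w @ [c]) = 2 * axis_coord w + (if c then axis_sign w else 0)"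
  by (simp add: axis_coord_def axis_sign_def)

lemma axis_sign_snoc [simp]: "axis_sign (w @ [c]) = (if c then axis_sign w else - axis_sign w)"
  by (simp add: axis_sign_def)

lemma axis_sign_cases:
  obtains "axis_sign w = 1" | "axis_sign w = - 1"
  using total_orientation_cases by (auto simp: axis_sign_def)

lemma total_orientation_axis_word:
  "a \<noteq> E \<Longrightarrow> total_orientation (axis_word a w) = axis_sign w"
  by (induction w rule: rev_induct) auto

lemma int_centroid_axis_word:
  "a \<noteq> E \<Longrightarrow> int_centroid (axis_word a w) = axis_point a (axis_coord w)"
  by (induction w rule: rev_induct)
    (auto simp: total_orientation_axis_word axis_point_def algebra_simps)

lemma axis_coord_mod_3:
  "(axis_coord w + axis_sign w) mod 3 = (- 1) ^ length w mod 3"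
  using int_centroid_mod_3[of "axis_word I w"]
  by (simp add: int_centroid_axis_word total_orientation_axis_word axis_point_def)

lemma axis_coord_inj:
  assumes "length w = length w'" "axis_coord w = axis_coord w'"
  shows "w = w'"
proof -
  have "axis_word I w = axis_word I w'"
    using assms by (intro int_centroid_inj) (simp_all add: int_centroid_axis_word)
  then show ?thesis
    by (simp add: axis_word_def inj_map_eq_map inj_def)
qed

lemma axis_coord_replicate_False: "axis_coord (replicate n False) = 0"
  by (induction n) (simp_all flip: replicate_append_same)

lemma axis_coord_eq_0_iff: "axis_coord w = 0 \<longleftrightarrow> w = replicate (length w) False"
  by (metis axis_coord_inj axis_coord_replicate_False length_replicate)

text \<open>
  One step of reading a centroid on an axis backwards. The lattice vectors of the four letters
  represent the four classes modulo 2, and a multiple of the vector of \<open>a\<close> is congruent to that vector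
  or to 0, so only \<open>a\<close> and \<open>E\<close> are possible as last letter; both leave the rest on the axis.
\<close>

lemma even_axis_point_imp:
  assumes "a \<noteq> E" "2 * x + s * fst (int_direction c) = t * fst (int_direction a)"
   "2 * y + s * snd (int_direction c) = t * snd (int_direction a)" "s = 1 \<or> s = - 1"
  shows "(c = a \<or> c = E) \<and> (\<exists>t'. (x, y) = axis_point a t')"
proof -
  have "c = a \<or> c = E"
    using assms by (cases a; cases c) (auto, presburger+)
  moreover have "\<exists>t'. (x, y) = axis_point a t'"
    unfolding axis_point_def
    by (rule exI[of _ "if a = I then x else if a = J then y else - x"], use assms calculation in \<open>cases a; auto\<close>)
  ultimately show ?thesis by blast
qed

lemma axis_wordI:
  assumes "a \<noteq> E" "int_centroid b = axis_point a t"
  shows "\<exists>w. b = axis_word a w"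
  using assms(2)
proof (induction b arbitrary: t rule: rev_induct)
  case Nil
  then show ?case by (intro exI[of _ "[]"]) simp
next
  case (snoc c b)
  have "(c = a \<or> c = E) \<and> (\<exists>t'. (fst (int_centroid b), snd (int_centroid b)) = axis_point a t')"
    using snoc.prems orientation_cases[of b "length b"]
    by (intro even_axis_point_imp[where s = "total_orientation b" and t = t] assms(1))
      (simp_all add: axis_point_def total_orientation_def)
  then obtain t' where c: "c = a \<or> c = E" and "int_centroid b = axis_point a t'" by auto
  with snoc.IH obtain w where "b = axis_word a w" by blast
  then have "b @ [c] = axis_word a (w @ [c = a])" using c by auto
  then show ?case ..
qed

section \<open>Triples of axis parameters with sum zero\<close>

type_synonym word_triple = "bool list \<times> bool list \<times> bool list"

definition word_triples :: "nat \<Rightarrow> word_triple set" where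
  "word_triples n = {(u, v, w). length u = n \<and> length v = n \<and> length w = n}"

fun coord_sum :: "word_triple \<Rightarrow> int" where
  "coord_sum (u, v, w) = axis_coord u + axis_coord v + axis_coord w"

fun extend :: "word_triple \<times> bool \<times> bool \<times> bool \<Rightarrow> word_triple" where
  "extend ((u, v, w), (a, b, c)) = (u @ [a], v @ [b], w @ [c])"

lemma inj_extend: "inj_on extend A"
  by (auto intro!: inj_onI)

lemma finite_word_triples: "finite (word_triples n)"
proof -
  have "word_triples n = {w. length w = n} \<times> {w. length w = n} \<times> {w. length w = n}"
    by (auto simp: word_triples_def)
  then show ?thesis using finite_lists_length_eq[of "UNIV :: bool set" n] by simp
qed

lemma coord_sum_mod_3:
  assumes "(u, v, w) \<in> word_triples n"
  shows "3 dvd coord_sum (u, v, w) + (axis_sign u + axis_sign v + axis_sign w)"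
proof -
  have "3 dvd axis_coord x + axis_sign x - (- 1) ^ n" if "length x = n" for x
    using axis_coord_mod_3[of x] that by (simp add: mod_eq_dvd_iff)
  then have "3 dvd (axis_coord u + axis_sign u - (- 1) ^ n) + (axis_coord v + axis_sign v - (- 1) ^ n)
      + (axis_coord w + axis_sign w - (- 1) ^ n) + 3 * (- 1) ^ n"
    using assms by (intro dvd_add) (auto simp: word_triples_def)
  then show ?thesis by (simp add: algebra_simps)
qed

lemma coord_sum_extend:
  "coord_sum (extend ((u, v, w), (a, b, c))) = 2 * coord_sum (u, v, w) +
    ((if a then axis_sign u else 0) + (if b then axis_sign v else 0) + (if c then axis_sign w else 0))"
  by simp

definition near_zero :: "nat \<Rightarrow> word_triple set" where
  "near_zero n = {t \<in> word_triples n. \<bar>coord_sum t\<bar> \<le> 1}"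

lemma finite_near_zero: "finite (near_zero n)"
  by (simp add: near_zero_def finite_word_triples)

definition zero_sum :: "nat \<Rightarrow> word_triple set" where
  "zero_sum n = {t \<in> word_triples n. coord_sum t = 0}"

text \<open>
  Let \<open>S\<close> be the sum before the extension. The new digits contribute at most 3 in absolute value, so
  \<open>\<bar>S\<bar> \<le> 2\<close>. For \<open>S = 2\<close> they would have to contribute \<open>- 3\<close>, hence all three signs would be \<open>- 1\<close>; then
  \<open>S\<close> would be divisible by 3, a contradiction. The case \<open>S = - 2\<close> is symmetric.
\<close>

lemma near_zero_parent:
  assumes "(u, v, w) \<in> word_triples n" "\<bar>coord_sum (extend ((u, v, w), (a, b, c)))\<bar> \<le> 1"
  shows "\<bar>coord_sum (u, v, w)\<bar> \<le> 1"
proof -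
  have "3 dvd S + (e + f + g) \<Longrightarrow>
      \<bar>2 * S + ((if a then e else 0) + (if b then f else 0) + (if c then g else 0))\<bar> \<le> 1
      \<Longrightarrow> \<bar>S\<bar> \<le> 1"
    if "e = 1 \<or> e = -1" "f = 1 \<or> f = -1" "g = 1 \<or> g = -1" for S e f g :: int
    using that by (elim disjE; cases a; cases b; cases c) (simp_all, presburger+)
  moreover have "axis_sign x = 1 \<or> axis_sign x = - 1" for x
    by (cases x rule: axis_sign_cases) auto
  ultimately show ?thesis
    using coord_sum_mod_3[OF assms(1)] assms(2) unfolding coord_sum_extend by blast
qed

text \<open>
  Removing the last digits of a triple whose sum is at most 1 in absolute value stays within the
  triples of that kind, so the longer triples can be counted by summing over the shorter ones.
\<close>

lemma extend_fibres:
  assumes "\<And>s. P s \<Longrightarrow> \<bar>s\<bar> \<le> 1"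
  shows "{t \<in> word_triples (Suc n). P (coord_sum t)} =
    extend ` (SIGMA t : near_zero n. {p. P (coord_sum (extend (t, p)))})"
proof (intro equalityI subsetI)
  fix t assume t: "t \<in> {t \<in> word_triples (Suc n). P (coord_sum t)}"
  obtain u v w where uvw: "t = (u, v, w)" by (cases t)
  obtain u' a v' b w' c where snoc: "u = u' @ [a]" "v = v' @ [b]" "w = w' @ [c]"
    using t uvw by (auto simp: word_triples_def length_Suc_conv_rev)
  have t_eq: "t = extend ((u', v', w'), (a, b, c))" using uvw snoc by simp
  have parent: "(u', v', w') \<in> word_triples n" using t uvw snoc by (auto simp: word_triples_def)
  have "(u', v', w') \<in> near_zero n"
    using near_zero_parent[OF parent, of a b c] assms t parent
    unfolding t_eq near_zero_def by blast
  then show "t \<in> extend ` (SIGMA t : near_zero n. {p. P (coord_sum (extend (t, p)))})"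
    using t unfolding t_eq by blast
next
  fix t assume "t \<in> extend ` (SIGMA t : near_zero n. {p. P (coord_sum (extend (t, p)))})"
  then show "t \<in> {t \<in> word_triples (Suc n). P (coord_sum t)}"
    by (auto simp: near_zero_def word_triples_def)
qed

lemma card_Collect_bool_triple:
  "card {p :: bool \<times> bool \<times> bool. P p} =
    (\<Sum>a\<in>UNIV. \<Sum>b\<in>UNIV. \<Sum>c\<in>UNIV. if P (a, b, c) then 1 else 0)"
proof -
  have "card {p :: bool \<times> bool \<times> bool. P p} = (\<Sum>p\<in>UNIV. if P p then 1 else 0)"
    by (simp add: sum.If_cases)
  also have "\<dots> = (\<Sum>a\<in>UNIV. \<Sum>b\<in>UNIV. \<Sum>c\<in>UNIV. if P (a, b, c) then 1 else 0)"
    by (simp add: sum.cartesian_product flip: UNIV_Times_UNIV)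
  finally show ?thesis .
qed

text \<open>
  If the sum is 0, the three signs agree, and the extended sum is this sign times the number of new
  digits 1: it is 0 for one choice of digits and \<open>\<plusminus>1\<close> for three. If the sum is \<open>s = \<plusminus>1\<close>, two of the signs
  are \<open>- s\<close> and one is \<open>s\<close>, and the extended sum is \<open>s (2 - a - b + c)\<close> after reordering the digits,
  which again is 0 for one choice and \<open>\<plusminus>1\<close> for three.
\<close>

lemma card_children:
  assumes "t \<in> near_zero n"
  shows "card {p. \<bar>coord_sum (extend (t, p))\<bar> \<le> 1} = 4"
    and "card {p. coord_sum (extend (t, p)) = 0} = 1"
proof -
  obtain u v w where t: "t = (u, v, w)" by (cases t)
  have dvd: "3 dvd coord_sum (u, v, w) + (axis_sign u + axis_sign v + axis_sign w)"
    using assms t by (intro coord_sum_mod_3[of _ _ _ n]) (simp add: near_zero_def)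
  have "coord_sum (u, v, w) = - 1 \<or> coord_sum (u, v, w) = 0 \<or> coord_sum (u, v, w) = 1"
    using assms t by (auto simp: near_zero_def)
  then have "card {p. \<bar>coord_sum (extend (t, p))\<bar> \<le> 1} = 4 \<and>
      card {p. coord_sum (extend (t, p)) = 0} = 1"
    using dvd unfolding t card_Collect_bool_triple coord_sum_extend
    by (elim disjE; cases u rule: axis_sign_cases; cases v rule: axis_sign_cases;
        cases w rule: axis_sign_cases) (simp_all add: UNIV_bool del: coord_sum.simps)
  then show "card {p. \<bar>coord_sum (extend (t, p))\<bar> \<le> 1} = 4"
    and "card {p. coord_sum (extend (t, p)) = 0} = 1" by auto
qed

lemma card_near_zero: "card (near_zero n) = 4 ^ n"
proof (induction n)
  case 0
  have "near_zero 0 = {([], [], [])}" by (auto simp: near_zero_def word_triples_def)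
  then show ?case by simp
next
  case (Suc n)
  have "card (near_zero (Suc n)) =
      card (SIGMA t : near_zero n. {p. \<bar>coord_sum (extend (t, p))\<bar> \<le> 1})"
    using extend_fibres[of "\<lambda>s. \<bar>s\<bar> \<le> 1" n] by (simp add: near_zero_def card_image inj_extend)
  also have "\<dots> = (\<Sum>t\<in>near_zero n. card {p. \<bar>coord_sum (extend (t, p))\<bar> \<le> 1})"
    by (rule card_SigmaI) (simp_all add: finite_near_zero)
  also have "\<dots> = (\<Sum>t\<in>near_zero n. 4)"
    by (rule sum.cong[OF refl]) (rule card_children(1))
  finally show ?case using Suc.IH by simp
qed

lemma card_zero_sum: "card (zero_sum (Suc n)) = 4 ^ n"
proof -
  have "card (zero_sum (Suc n)) = card (SIGMA t : near_zero n. {p. coord_sum (extend (t, p)) = 0})"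
    using extend_fibres[of "\<lambda>s. s = 0" n] by (simp add: zero_sum_def card_image inj_extend)
  also have "\<dots> = (\<Sum>t\<in>near_zero n. card {p. coord_sum (extend (t, p)) = 0})"
    by (rule card_SigmaI) (simp_all add: finite_near_zero)
  also have "\<dots> = (\<Sum>t\<in>near_zero n. 1)"
    by (rule sum.cong[OF refl]) (rule card_children(2))
  finally show ?thesis by (simp add: card_near_zero)
qed


section \<open>Equilateral triangles in the lattice\<close>

definition lattice_point :: "int \<times> int \<Rightarrow> real \<times> real" where
  "lattice_point p = real_of_int (fst p) *\<^sub>R direction I + real_of_int (snd p) *\<^sub>R direction J"

text \<open>
  The squared length of a lattice point; the sign of the mixed term comes from the angle of 120 degrees.
\<close>

definition lattice_norm :: "int \<times> int \<Rightarrow> int" where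
  "lattice_norm p = (fst p)\<^sup>2 - fst p * snd p + (snd p)\<^sup>2"

definition lattice_equilateral :: "int \<times> int \<Rightarrow> int \<times> int \<Rightarrow> int \<times> int \<Rightarrow> bool" where
  "lattice_equilateral p q r \<longleftrightarrow> p \<noteq> q \<and> lattice_norm (p - q) = lattice_norm (q - r) \<and>
    lattice_norm (q - r) = lattice_norm (r - p)"

lemma direction_explicit:
  "direction I = (- (sqrt 3 / 2), - (1 / 2))"
  "direction J = (0, 1)"
  "direction K = (sqrt 3 / 2, - (1 / 2))"
proof -
  have "210 * pi / 180 = pi / 6 + pi" "330 * pi / 180 = - (pi / 6) + 2 * pi" "90 * pi / 180 = pi / 2"
    by (simp_all add: field_simps)
  then show "direction I = (- (sqrt 3 / 2), - (1 / 2))" "direction J = (0, 1)"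
    "direction K = (sqrt 3 / 2, - (1 / 2))"
    by (simp_all only: direction.simps sin_periodic cos_periodic sin_periodic_pi cos_periodic_pi
        sin_minus cos_minus sin_30 cos_30 sin_pi_half cos_pi_half)
qed

lemma direction_eq_lattice_point: "direction a = lattice_point (int_direction a)"
  by (cases a) (simp_all add: lattice_point_def direction_explicit del: direction.simps(1-3))

lemma centroid_eq_lattice_point:
  "centroid d b = (2 * d / 2 ^ length b) *\<^sub>R lattice_point (int_centroid b)"
proof (induction b rule: rev_induct)
  case Nil
  then show ?case by (simp add: centroid_def lattice_point_def del: direction.simps)
next
  case (snoc c b)
  then show ?case
    by (simp add: centroid_snoc direction_eq_lattice_point[of c] lattice_point_def
        scaleR_add_right scaleR_add_left algebra_simps add_divide_distrib del: direction.simps)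
qed

lemma dist_lattice_point:
  "dist (lattice_point p) (lattice_point q) = sqrt (real_of_int (lattice_norm (p - q)))"
proof -
  have *: "(sqrt 3 * X)\<^sup>2 = 3 * X\<^sup>2" for X :: real by (simp add: power_mult_distrib)
  have "(- (X * sqrt 3 / 2) + X' * sqrt 3 / 2)\<^sup>2 + (- (X / 2) + Y - (- (X' / 2) + Y'))\<^sup>2
     = (X - X')\<^sup>2 - (X - X') * (Y - Y') + (Y - Y')\<^sup>2" for X X' Y Y' :: real
    using *[of "(X' - X) / 2"] by (simp add: power2_eq_square field_simps)
  then show ?thesis
    by (simp add: dist_norm norm_prod_def lattice_point_def lattice_norm_def direction_explicit
        del: direction.simps)
qed

lemma equilateral_centroid_iff:
  assumes "d > 0" "b1 \<in> words n" "b2 \<in> words n" "b3 \<in> words n"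
  shows "equilateral (centroid d b1) (centroid d b2) (centroid d b3) \<longleftrightarrow>
    lattice_equilateral (int_centroid b1) (int_centroid b2) (int_centroid b3)"
proof -
  have scale: "dist (k *\<^sub>R x) (k *\<^sub>R y) = \<bar>k\<bar> * dist x y" for k and x y :: "real \<times> real"
    by (simp add: dist_norm flip: scaleR_diff_right)
  have "dist (centroid d b) (centroid d b') =
      (2 * d / 2 ^ n) * sqrt (real_of_int (lattice_norm (int_centroid b - int_centroid b')))"
    if "b \<in> words n" "b' \<in> words n" for b b'
    using that assms(1) by (simp add: centroid_eq_lattice_point words_def scale dist_lattice_point)
  moreover have "centroid d b1 = centroid d b2 \<longleftrightarrow> int_centroid b1 = int_centroid b2"
    using assms by (auto simp: centroid_eq_lattice_point words_def lattice_point_def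
        direction_explicit prod_eq_iff simp del: direction.simps)
  ultimately show ?thesis
    using assms by (simp add: equilateral_def lattice_equilateral_def)
qed

lemma centroid_in_main_axis_iff:
  assumes "d > 0" "a \<noteq> E"
  shows "centroid d b \<in> main_axis a \<longleftrightarrow> (\<exists>t. int_centroid b = axis_point a t)"
proof
  assume "\<exists>t. int_centroid b = axis_point a t"
  then obtain t where t: "int_centroid b = axis_point a t" ..
  have "lattice_point (axis_point a t) = real_of_int t *\<^sub>R direction a"
    by (simp add: direction_eq_lattice_point[of a] lattice_point_def axis_point_def algebra_simps
        del: direction.simps)
  then have "centroid d b = (2 * d / 2 ^ length b * real_of_int t) *\<^sub>R direction a"
    by (simp add: centroid_eq_lattice_point t)
  then show "centroid d b \<in> main_axis a"
    unfolding main_axis_def span_singleton by (rule range_eqI)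
next
  assume "centroid d b \<in> main_axis a"
  then obtain k where k: "(2 * d / 2 ^ length b) *\<^sub>R lattice_point (int_centroid b) = k *\<^sub>R direction a"
    by (auto simp: centroid_eq_lattice_point main_axis_def span_singleton simp del: direction.simps)
  define m where "m = k / (2 * d / 2 ^ length b)"
  have "lattice_point (int_centroid b) = m *\<^sub>R direction a"
    using arg_cong[OF k, of "\<lambda>x. (1 / (2 * d / 2 ^ length b)) *\<^sub>R x"] assms(1)
    by (simp add: m_def del: direction.simps)
  moreover obtain X Y where XY: "int_centroid b = (X, Y)" by (cases "int_centroid b")
  moreover have "- (x * sqrt 3) = m * sqrt 3 \<longleftrightarrow> m = - x" for x
    using mult_cancel_right[of "- x" "sqrt 3" m] by auto
  ultimately have "int_centroid b = axis_point a (if a = I then X else if a = J then Y else - X)"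
    using assms(2)
    by (cases a) (auto simp: axis_point_def lattice_point_def direction_explicit
        simp del: direction.simps(1-3))
  then show "\<exists>t. int_centroid b = axis_point a t" by blast
qed

lemma lattice_norm_eq_0_iff: "lattice_norm p = 0 \<longleftrightarrow> p = (0, 0)"
proof -
  have "4 * lattice_norm p = (2 * fst p - snd p)\<^sup>2 + 3 * (snd p)\<^sup>2"
    by (simp add: lattice_norm_def power2_eq_square algebra_simps)
  moreover have "(2 * fst p - snd p)\<^sup>2 \<ge> 0" "(snd p)\<^sup>2 \<ge> 0" by simp_all
  ultimately have "lattice_norm p = 0 \<Longrightarrow> (2 * fst p - snd p)\<^sup>2 = 0 \<and> (snd p)\<^sup>2 = 0"
    by linarith
  then show ?thesis by (auto simp: lattice_norm_def prod_eq_iff)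
qed

lemma lattice_norm_diff_eq_0_iff: "lattice_norm (p - q) = 0 \<longleftrightarrow> p = q"
  by (auto simp: lattice_norm_eq_0_iff prod_eq_iff)

lemma lattice_equilateral_distinct:
  assumes "lattice_equilateral p q r"
  shows "p \<noteq> q" "q \<noteq> r" "r \<noteq> p"
  using assms by (metis lattice_equilateral_def lattice_norm_diff_eq_0_iff)+

lemma lattice_norm_same_axis:
  "a \<noteq> E \<Longrightarrow> lattice_norm (axis_point a s - axis_point a t) = (s - t)\<^sup>2"
  by (cases a) (auto simp: lattice_norm_def axis_point_def power2_eq_square algebra_simps)

lemma lattice_norm_distinct_axes:
  "\<lbrakk>a \<noteq> E; b \<noteq> E; a \<noteq> b\<rbrakk> \<Longrightarrow>
    lattice_norm (axis_point a s - axis_point b t) = s\<^sup>2 + s * t + t\<^sup>2"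
  by (cases a; cases b) (auto simp: lattice_norm_def axis_point_def power2_eq_square algebra_simps)

lemma axis_point_eq_iff:
  "\<lbrakk>a \<noteq> E; b \<noteq> E; a \<noteq> b\<rbrakk> \<Longrightarrow> axis_point a s = axis_point b t \<longleftrightarrow> s = 0 \<and> t = 0"
  by (cases a; cases b) (auto simp: axis_point_def)

text \<open>
  The difference of \<open>x\<^sup>2 + x y + y\<^sup>2\<close> and \<open>y\<^sup>2 + y z + z\<^sup>2\<close> is \<open>(x - z) (x + y + z)\<close>. So unless the sum
  vanishes, equal distances force equal parameters.
\<close>

lemma lattice_equilateral_three_axes:
  assumes "distinct [a, b, c, E]"
  shows "lattice_equilateral (axis_point a s) (axis_point b t) (axis_point c u) \<longleftrightarrow>
    (s = t \<and> t = u \<or> s + t + u = 0) \<and> \<not> (s = 0 \<and> t = 0 \<and> u = 0)"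
proof -
  have factor: "x\<^sup>2 + x * y + y\<^sup>2 = y\<^sup>2 + y * z + z\<^sup>2 \<longleftrightarrow> x = z \<or> x + y + z = 0" for x y z :: int
  proof -
    have "x\<^sup>2 + x * y + y\<^sup>2 - (y\<^sup>2 + y * z + z\<^sup>2) = (x - z) * (x + y + z)"
      by (simp add: power2_eq_square algebra_simps)
    then show ?thesis by (metis eq_iff_diff_eq_0 mult_eq_0_iff)
  qed
  have "lattice_norm (axis_point a s - axis_point b t) = s\<^sup>2 + s * t + t\<^sup>2"
    "lattice_norm (axis_point b t - axis_point c u) = t\<^sup>2 + t * u + u\<^sup>2"
    "lattice_norm (axis_point c u - axis_point a s) = u\<^sup>2 + u * s + s\<^sup>2"
    "axis_point a s = axis_point b t \<longleftrightarrow> s = 0 \<and> t = 0"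
    using assms by (auto simp: lattice_norm_distinct_axes axis_point_eq_iff)
  then have "lattice_equilateral (axis_point a s) (axis_point b t) (axis_point c u) \<longleftrightarrow>
      \<not> (s = 0 \<and> t = 0) \<and> (s = u \<or> s + t + u = 0) \<and> (t = s \<or> t + u + s = 0)"
    by (simp only: lattice_equilateral_def factor)
  then show ?thesis by auto
qed

text \<open>
  Three distinct points of one axis cannot be equidistant, so a third vertex lies on another axis.
  It is equidistant from the two on the common axis, which gives
  \<open>u = - (s + t)\<close>; comparing with the third side then leaves \<open>s t = 0\<close>.
\<close>

lemma lattice_equilateral_same_axis:
  assumes "a \<noteq> E" "b \<noteq> E"
    and "lattice_equilateral (axis_point a s) (axis_point a t) (axis_point b u)"
  shows "a \<noteq> b \<and> (s = 0 \<or> t = 0)"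
proof -
  have ne: "s \<noteq> t" using lattice_equilateral_distinct[OF assms(3)] by auto
  have "a \<noteq> b"
  proof
    assume "a = b"
    then have "(s - t)\<^sup>2 = (t - u)\<^sup>2" "(t - u)\<^sup>2 = (u - s)\<^sup>2"
      using assms by (auto simp: lattice_equilateral_def lattice_norm_same_axis)
    then show False using ne by (auto simp: power2_eq_iff)
  qed
  then have eqs: "(s - t)\<^sup>2 = t\<^sup>2 + t * u + u\<^sup>2" "t\<^sup>2 + t * u + u\<^sup>2 = u\<^sup>2 + u * s + s\<^sup>2"
    using assms
    by (auto simp: lattice_equilateral_def lattice_norm_same_axis lattice_norm_distinct_axes)
  have "(t - s) * (s + t + u) = 0" using eqs(2) by (simp add: power2_eq_square algebra_simps)
  then have "u = - (s + t)" using ne by auto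
  with eqs(1) have "s * t = 0" by (simp add: power2_eq_square algebra_simps)
  then show ?thesis using \<open>a \<noteq> b\<close> by simp
qed

lemma third_axis:
  assumes "a \<noteq> E" "b \<noteq> E" "a \<noteq> b"
  obtains c where "distinct [a, b, c, E]"
proof -
  have "\<exists>c. distinct [a, b, c, E]"
    using assms by (cases a; cases b) (auto intro: exI[of _ I] exI[of _ J] exI[of _ K])
  then show ?thesis using that by blast
qed

lemma lattice_equilateral_rotate: "lattice_equilateral p q r \<Longrightarrow> lattice_equilateral q r p"
  using lattice_equilateral_distinct[of p q r] by (auto simp: lattice_equilateral_def)

text \<open>
  The vertex set of an equilateral triangle whose vertices can be assigned to the three axes. Being a
  property of the set, it allows the vertices to be taken in any order.
\<close>

definition axis_labelled :: "(int \<times> int) set \<Rightarrow> bool" where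
  "axis_labelled S \<longleftrightarrow> (\<exists>x y z. S = {axis_point I x, axis_point J y, axis_point K z} \<and>
    lattice_equilateral (axis_point I x) (axis_point J y) (axis_point K z))"

lemma axis_labelled_distinct_axes:
  assumes "distinct [a, b, c, E]"
    and "lattice_equilateral (axis_point a s) (axis_point b t) (axis_point c u)"
  shows "axis_labelled {axis_point a s, axis_point b t, axis_point c u}"
proof -
  define x where "x e = (if e = a then s else if e = b then t else u)" for e
  have set: "{axis_point a s, axis_point b t, axis_point c u} =
      {axis_point I (x I), axis_point J (x J), axis_point K (x K)}"
    using assms(1) by (cases a; cases b; cases c) (auto simp: x_def)
  have "lattice_equilateral (axis_point I (x I)) (axis_point J (x J)) (axis_point K (x K))"
    using assms by (cases a; cases b; cases c) (auto simp: x_def lattice_equilateral_three_axes)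
  with set show ?thesis unfolding axis_labelled_def by blast
qed

text \<open>
  The vertex at the origin is moved to the axis that carries no other vertex.
\<close>

lemma axis_labelled_same_axis:
  assumes "a \<noteq> E" "b \<noteq> E"
    and eq: "lattice_equilateral (axis_point a s) (axis_point a t) (axis_point b u)"
  shows "axis_labelled {axis_point a s, axis_point a t, axis_point b u}"
proof -
  have "a \<noteq> b" and zero: "s = 0 \<or> t = 0" using lattice_equilateral_same_axis[OF assms] by auto
  then obtain c where c: "distinct [a, b, c, E]" using third_axis assms by metis
  have origin: "axis_point a 0 = axis_point c 0" by (simp add: axis_point_def)
  from zero show ?thesis
  proof
    assume s: "s = 0"
    then have "axis_labelled {axis_point c 0, axis_point a t, axis_point b u}"
      using c eq origin by (intro axis_labelled_distinct_axes) auto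
    then show ?thesis using s origin by simp
  next
    assume t: "t = 0"
    then have "axis_labelled {axis_point a s, axis_point c 0, axis_point b u}"
      using c eq origin by (intro axis_labelled_distinct_axes) auto
    then show ?thesis using t origin by simp
  qed
qed

lemma axis_labelled_axes:
  assumes "a \<noteq> E" "b \<noteq> E" "c \<noteq> E"
    and eq: "lattice_equilateral (axis_point a s) (axis_point b t) (axis_point c u)"
  shows "axis_labelled {axis_point a s, axis_point b t, axis_point c u}"
proof -
  consider "a = b" | "b = c" | "c = a" | "distinct [a, b, c, E]" using assms by auto
  then show ?thesis
  proof cases
    case 1
    then show ?thesis using axis_labelled_same_axis[of a c s t u] assms by simp
  next
    case 2
    then show ?thesis
      using axis_labelled_same_axis[of b a t u s] lattice_equilateral_rotate[OF eq] assms
      by (simp add: insert_commute)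
  next
    case 3
    then show ?thesis
      using axis_labelled_same_axis[of a b u s t]
        lattice_equilateral_rotate[OF lattice_equilateral_rotate[OF eq]] assms
      by (simp add: insert_commute)
  next
    case 4
    then show ?thesis using axis_labelled_distinct_axes eq by blast
  qed
qed

section \<open>Axial triangles as triples of binary words\<close>

fun triangle_of :: "word_triple \<Rightarrow> letter list set" where
  "triangle_of (u, v, w) = {axis_word I u, axis_word J v, axis_word K w}"

definition equal_words :: "nat \<Rightarrow> word_triple set" where
  "equal_words n = (\<lambda>w. (w, w, w)) ` {w. length w = n}"

text \<open>
  The triple all of whose entries have parameter 0. It satisfies the conditions of both branches, but
  its three points coincide.
\<close>

definition origin_triple :: "nat \<Rightarrow> word_triple" where
  "origin_triple n = (replicate n False, replicate n False, replicate n False)"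

lemma axis_labelling_triangle_of:
  "axis_labelling (triangle_of (u, v, w)) x y z \<longleftrightarrow>
    x = axis_coord u \<and> y = axis_coord v \<and> z = axis_coord w"
proof -
  have "axis_labelling (triangle_of (u, v, w)) (axis_coord u) (axis_coord v) (axis_coord w)"
    unfolding axis_labelling_def
    by (intro exI[of _ "axis_word I u"] exI[of _ "axis_word J v"] exI[of _ "axis_word K w"])
      (simp add: int_centroid_axis_word axis_point_def)
  then show ?thesis using axis_labelling_unique by blast
qed

lemma inj_on_triangle_of: "inj_on triangle_of (word_triples n)"
proof (rule inj_onI)
  fix t t' assume t: "t \<in> word_triples n" "t' \<in> word_triples n" "triangle_of t = triangle_of t'"
  obtain u v w u' v' w' where uvw: "t = (u, v, w)" "t' = (u', v', w')" by (cases t; cases t')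
  have "axis_labelling (triangle_of (u, v, w)) (axis_coord u') (axis_coord v') (axis_coord w')"
    using t uvw axis_labelling_triangle_of by metis
  then show "t = t'"
    using t uvw by (auto simp: axis_labelling_triangle_of word_triples_def simp del: triangle_of.simps
        intro: axis_coord_inj)
qed

lemma equal_words_iff:
  assumes "(u, v, w) \<in> word_triples n"
  shows "(u, v, w) \<in> equal_words n \<longleftrightarrow> axis_coord u = axis_coord v \<and> axis_coord v = axis_coord w"
  using assms by (auto simp: equal_words_def word_triples_def dest!: axis_coord_inj[rotated])

lemma zero_sum_iff:
  assumes "(u, v, w) \<in> word_triples n"
  shows "(u, v, w) \<in> zero_sum n \<longleftrightarrow> axis_coord u + axis_coord v + axis_coord w = 0"
  using assms by (simp add: zero_sum_def)

lemma origin_triple_iff: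
  assumes "(u, v, w) \<in> word_triples n"
  shows "(u, v, w) = origin_triple n \<longleftrightarrow> axis_coord u = 0 \<and> axis_coord v = 0 \<and> axis_coord w = 0"
proof -
  have "axis_coord x = 0 \<longleftrightarrow> x = replicate n False" if "length x = n" for x
    using that axis_coord_eq_0_iff[of x] by simp
  then show ?thesis using assms by (simp add: origin_triple_def word_triples_def)
qed

lemma branches_subset: "equal_words n \<subseteq> word_triples n" "zero_sum n \<subseteq> word_triples n"
  by (auto simp: equal_words_def zero_sum_def word_triples_def)

lemma origin_in_word_triples: "origin_triple n \<in> word_triples n"
  by (simp add: origin_triple_def word_triples_def)

lemma lattice_equilateral_triangle_of_iff:
  assumes "(u, v, w) \<in> word_triples n"
  shows "lattice_equilateral (axis_point I (axis_coord u)) (axis_point J (axis_coord v))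
      (axis_point K (axis_coord w)) \<longleftrightarrow>
    (u, v, w) \<in> equal_words n \<union> zero_sum n - {origin_triple n}"
  using assms
  by (simp add: lattice_equilateral_three_axes equal_words_iff zero_sum_iff origin_triple_iff)

lemma triangle_of_axial:
  assumes "d > 0" and t: "(u, v, w) \<in> equal_words n \<union> zero_sum n - {origin_triple n}"
  shows "triangle_of (u, v, w) \<in> axial_triangles d n"
proof -
  have len: "(u, v, w) \<in> word_triples n" using t branches_subset by auto
  have words: "axis_word I u \<in> words n" "axis_word J v \<in> words n" "axis_word K w \<in> words n"
    using len by (auto simp: words_def word_triples_def)
  have eq: "lattice_equilateral (int_centroid (axis_word I u)) (int_centroid (axis_word J v))
      (int_centroid (axis_word K w))"
    using lattice_equilateral_triangle_of_iff[OF len] t by (simp add: int_centroid_axis_word)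
  have "distinct [axis_word I u, axis_word J v, axis_word K w]"
    using lattice_equilateral_distinct[OF eq] by auto
  then have "triangle_of (u, v, w) \<in> triangles d n"
    using words eq equilateral_centroid_iff[OF assms(1) words]
    unfolding triangles_def triangle_of.simps by blast
  moreover have "centroid d (axis_word a x) \<in> main_axis a" if "a \<noteq> E" for a x
    using that assms(1) by (auto simp: centroid_in_main_axis_iff int_centroid_axis_word)
  ultimately show ?thesis by (auto simp: axial_triangles_def)
qed

lemma axial_triangle_labelled:
  assumes "d > 0" "T \<in> axial_triangles d n"
  shows "T \<subseteq> words n" "axis_labelled (int_centroid ` T)"
proof -
  obtain b1 b2 b3 where T: "T = {b1, b2, b3}" and words: "b1 \<in> words n" "b2 \<in> words n" "b3 \<in> words n"
    and equi: "equilateral (centroid d b1) (centroid d b2) (centroid d b3)"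
    using assms(2) unfolding axial_triangles_def triangles_def by blast
  have axis: "\<exists>a t. a \<noteq> E \<and> int_centroid b = axis_point a t" if b: "b \<in> T" for b
  proof -
    obtain a where a: "a \<noteq> E" "centroid d b \<in> main_axis a"
      using assms(2) b unfolding axial_triangles_def by blast
    then show ?thesis using centroid_in_main_axis_iff[OF assms(1) a(1)] by metis
  qed
  obtain a1 t1 where p1: "a1 \<noteq> E" "int_centroid b1 = axis_point a1 t1" using axis[of b1] T by auto
  obtain a2 t2 where p2: "a2 \<noteq> E" "int_centroid b2 = axis_point a2 t2" using axis[of b2] T by auto
  obtain a3 t3 where p3: "a3 \<noteq> E" "int_centroid b3 = axis_point a3 t3" using axis[of b3] T by auto
  show "T \<subseteq> words n" using T words by blast
  have "lattice_equilateral (axis_point a1 t1) (axis_point a2 t2) (axis_point a3 t3)"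
    using equi equilateral_centroid_iff[OF assms(1) words] unfolding p1(2) p2(2) p3(2) by blast
  then have "axis_labelled {axis_point a1 t1, axis_point a2 t2, axis_point a3 t3}"
    using axis_labelled_axes p1(1) p2(1) p3(1) by blast
  then show "axis_labelled (int_centroid ` T)"
    by (simp only: T image_insert image_empty p1(2) p2(2) p3(2))
qed

text \<open>
  A triangle is determined by the centroids of its vertices, since the centroid map is injective, and
  each of these centroids comes from a unique binary word on its axis.
\<close>

lemma axial_triangles_as_triples:
  assumes "d > 0"
  shows "axial_triangles d n = triangle_of ` (equal_words n \<union> zero_sum n - {origin_triple n})"
proof (intro equalityI subsetI)
  fix T assume T: "T \<in> axial_triangles d n"
  note TW = axial_triangle_labelled(1)[OF assms T]
  obtain x y z where img: "int_centroid ` T = {axis_point I x, axis_point J y, axis_point K z}"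
    and eq: "lattice_equilateral (axis_point I x) (axis_point J y) (axis_point K z)"
    using axial_triangle_labelled(2)[OF assms T] unfolding axis_labelled_def by blast
  have word: "\<exists>w. length w = n \<and> s = axis_coord w"
    if a: "a \<noteq> E" and s: "axis_point a s \<in> int_centroid ` T" for a s
  proof -
    obtain b where b: "b \<in> T" "int_centroid b = axis_point a s" using s by (metis imageE)
    then obtain w where w: "b = axis_word a w" using axis_wordI a by blast
    have "axis_point a s = axis_point a (axis_coord w)"
      using b w a by (simp add: int_centroid_axis_word)
    then have "s = axis_coord w" using a by (cases a) (auto simp: axis_point_def)
    moreover have "length w = n" using b w TW by (auto simp: words_def)
    ultimately show ?thesis by blast
  qed
  obtain u where u: "length u = n" "x = axis_coord u" using word[of I x] by (auto simp: img)
  obtain v where v: "length v = n" "y = axis_coord v" using word[of J y] by (auto simp: img)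
  obtain w where w: "length w = n" "z = axis_coord w" using word[of K z] by (auto simp: img)
  have len: "(u, v, w) \<in> word_triples n" using u v w by (simp add: word_triples_def)
  have "int_centroid ` triangle_of (u, v, w) = int_centroid ` T"
    unfolding img u(2) v(2) w(2) by (simp add: int_centroid_axis_word)
  moreover have "triangle_of (u, v, w) \<subseteq> words n"
    using u v w by (simp add: words_def)
  moreover have "inj_on int_centroid (words n)"
    by (rule inj_onI) (auto simp: words_def intro: int_centroid_inj)
  ultimately have "triangle_of (u, v, w) = T"
    using TW inj_on_image_eq_iff by blast
  moreover have "(u, v, w) \<in> equal_words n \<union> zero_sum n - {origin_triple n}"
    using lattice_equilateral_triangle_of_iff[OF len] eq unfolding u(2) v(2) w(2) by blast
  ultimately show "T \<in> triangle_of ` (equal_words n \<union> zero_sum n - {origin_triple n})" by blast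
next
  fix T assume "T \<in> triangle_of ` (equal_words n \<union> zero_sum n - {origin_triple n})"
  then obtain t where t: "T = triangle_of t" "t \<in> equal_words n \<union> zero_sum n - {origin_triple n}"
    by blast
  then show "T \<in> axial_triangles d n"
    using triangle_of_axial[OF assms] by (cases t) blast
qed

lemma equal_branch_as_triples:
  assumes "d > 0"
  shows "axial_triangles_eq d n = triangle_of ` (equal_words n - {origin_triple n})"
proof -
  have "(\<exists>x y z. axis_labelling (triangle_of t) x y z \<and> x = y \<and> y = z) \<longleftrightarrow> t \<in> equal_words n"
    if "t \<in> word_triples n" for t
    using that by (cases t) (simp add: axis_labelling_triangle_of equal_words_iff del: triangle_of.simps)
  then show ?thesis
    unfolding axial_triangles_eq_def axial_triangles_as_triples[OF assms]
    using branches_subset by blast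
qed

lemma zero_branch_as_triples:
  assumes "d > 0"
  shows "axial_triangles_zero d n = triangle_of ` (zero_sum n - {origin_triple n})"
proof -
  have "(\<exists>x y z. axis_labelling (triangle_of t) x y z \<and> x + y + z = 0) \<longleftrightarrow> t \<in> zero_sum n"
    if "t \<in> word_triples n" for t
    using that by (cases t) (simp add: axis_labelling_triangle_of zero_sum_iff del: triangle_of.simps)
  then show ?thesis
    unfolding axial_triangles_zero_def axial_triangles_as_triples[OF assms]
    using branches_subset by blast
qed

lemma branches_meet_in_origin: "equal_words n \<inter> zero_sum n = {origin_triple n}"
proof -
  have "t \<in> equal_words n \<and> t \<in> zero_sum n \<longleftrightarrow> t = origin_triple n" if "t \<in> word_triples n" for t
    using that by (cases t) (auto simp: equal_words_iff zero_sum_iff origin_triple_iff)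
  then show ?thesis using branches_subset origin_in_word_triples by blast
qed

lemma card_equal_words: "card (equal_words n) = 2 ^ n"
proof -
  have "inj_on (\<lambda>w :: bool list. (w, w, w)) {w. length w = n}" by (auto intro: inj_onI)
  then show ?thesis
    using card_lists_length_eq[of "UNIV :: bool set" n] by (simp add: equal_words_def card_image)
qed

theorem theorem7p4:
  fixes n :: nat and d :: real
  assumes "n \<ge> 1" and "d > 0"
  shows "card (axial_triangles d n) = 4 ^ (n - 1) + 2 ^ n - 2 \<and>
    (\<forall>T\<in>axial_triangles d n. \<exists>x\<in>axis_params n. \<exists>y\<in>axis_params n. \<exists>z\<in>axis_params n.
        axis_labelling T x y z) \<and>
    (\<forall>T\<in>axial_triangles d n.
        (T \<in> axial_triangles_eq d n \<or> T \<in> axial_triangles_zero d n) \<and>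
        \<not> (T \<in> axial_triangles_eq d n \<and> T \<in> axial_triangles_zero d n)) \<and>
    card (axial_triangles_eq d n) = 2 ^ n - 1 \<and>
    card (axial_triangles_zero d n) = 4 ^ (n - 1) - 1"
proof -
  note inj = inj_on_triangle_of[of n]
  note images = axial_triangles_as_triples[OF assms(2), of n]
    equal_branch_as_triples[OF assms(2), of n] zero_branch_as_triples[OF assms(2), of n]
  note sub = branches_subset[of n]
  note meet = branches_meet_in_origin[of n]
  have origin: "origin_triple n \<in> equal_words n" "origin_triple n \<in> zero_sum n"
    using meet by blast+
  have fin: "finite (equal_words n)" "finite (zero_sum n)"
    using sub finite_word_triples finite_subset by blast+
  have card_zero: "card (zero_sum n) = 4 ^ (n - 1)"
    using card_zero_sum[of "n - 1"] assms(1) by simp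
  have card_eq_branch: "card (axial_triangles_eq d n) = 2 ^ n - 1"
  proof -
    have "card (axial_triangles_eq d n) = card (equal_words n - {origin_triple n})"
      unfolding images by (intro card_image inj_on_subset[OF inj]) (use sub in blast)
    then show ?thesis using fin by (simp add: origin card_equal_words)
  qed
  have card_zero_branch: "card (axial_triangles_zero d n) = 4 ^ (n - 1) - 1"
  proof -
    have "card (axial_triangles_zero d n) = card (zero_sum n - {origin_triple n})"
      unfolding images by (intro card_image inj_on_subset[OF inj]) (use sub in blast)
    then show ?thesis using fin by (simp add: origin card_zero)
  qed
  have union: "axial_triangles d n = axial_triangles_eq d n \<union> axial_triangles_zero d n"
    unfolding images by blast
  have disjoint: "axial_triangles_eq d n \<inter> axial_triangles_zero d n = {}"
  proof -
    have "axial_triangles_eq d n \<inter> axial_triangles_zero d n =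
        triangle_of ` ((equal_words n - {origin_triple n}) \<inter> (zero_sum n - {origin_triple n}))"
      unfolding images by (rule inj_on_image_Int[OF inj, symmetric]) (use sub in blast)+
    then show ?thesis using meet by blast
  qed
  have "card (axial_triangles d n) = (2 ^ n - 1) + (4 ^ (n - 1) - 1)"
    unfolding union card_eq_branch[symmetric] card_zero_branch[symmetric]
    using disjoint fin by (intro card_Un_disjoint) (simp_all add: images)
  moreover have "(2::nat) ^ n \<ge> 1" "(4::nat) ^ (n - 1) \<ge> 1" by simp_all
  ultimately have card: "card (axial_triangles d n) = 4 ^ (n - 1) + 2 ^ n - 2" by linarith
  have labels: "\<exists>x\<in>axis_params n. \<exists>y\<in>axis_params n. \<exists>z\<in>axis_params n. axis_labelling T x y z"
    if T: "T \<in> axial_triangles d n" for T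
  proof -
    obtain t where t: "T = triangle_of t" "t \<in> word_triples n"
      using T sub unfolding images by blast
    obtain u v w where uvw: "t = (u, v, w)" by (cases t)
    have param: "axis_coord x \<in> axis_params n" if "length x = n" for x
    proof -
      have "(axis_coord x, 0) = int_centroid (axis_word I x)"
        by (simp add: int_centroid_axis_word axis_point_def)
      moreover have "axis_word I x \<in> words n" using that by (simp add: words_def)
      ultimately show ?thesis unfolding axis_params_def by blast
    qed
    have "axis_labelling T (axis_coord u) (axis_coord v) (axis_coord w)"
      unfolding t(1) uvw axis_labelling_triangle_of by simp
    moreover have "length u = n" "length v = n" "length w = n"
      using t(2) uvw by (auto simp: word_triples_def)
    ultimately show ?thesis using param by blast
  qed
  show ?thesis
    using card labels union disjoint card_eq_branch card_zero_branch by blast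
qed

end
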